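(* Let $A$ be an ordered commutative monoid. Then the following conditions are equivalent: (a) $A$ is numerical via some functional $f:A\to\mathbb{R}$, i.e. $x\geq y\Leftrightarrow f(x)\geq f(y)$ for all $x,y\in A$. (b) $A$ is totally ordered, and satisfies the conditions: (i) if $x>y$, then $x+z>y+z$ for all $z\in A$; (ii) if $x>y>z$, then there exists a rational $\varepsilon\in(0,1)$ such that for all $n,k\in\mathbb{N}$ with $n\geq1$ and $k\leq\varepsilon n$, $$(n-k)x+kz>ny>kx+(n-k)z.$$ (c) $A$ is totally ordered, and if $x,y,z_+,z_-\in A$ are such that for all rational $\varepsilon>0$ there exist $n,k\in\mathbb{N}$ with $n\geq 1$, $k\leq\varepsilon n$ and $$nx+kz_+\geq ny+kz_-,$$ then $x\geq y$. If these conditions hold, then any functional $f':A\to\mathbb{R}$ is a (real) scalar multiple of the functional $f$ in (a).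
   Context: $\mathbb{N}=\{0,1,2,\dots\}$. An ordered commutative monoid is a set $A$ with a partial order $\geq$ (reflexive, transitive, antisymmetric) and a commutative monoid structure $(+,0)$ such that $x\geq y$ implies $x+z\geq y+z$; $nx$ denotes the $n$-fold sum. $x>y$ means $x\geq y$ and $y\not\geq x$. $A$ is totally ordered if for all $x,y\in A$, $x\geq y$ or $y\geq x$. A functional on $A$ is a map $f:A\to\mathbb{R}$ with $x\geq y\Rightarrow f(x)\geq f(y)$, $f(x+y)=f(x)+f(y)$, $f(0)=0$. *)

theory Defs
  imports Complex_Main
begin

text \<open>
  Ordered commutative monoids are types of class \<open>ordered_comm_monoid_add\<close>: a partial order
  and a commutative monoid whose addition is monotone. That class assumes no positivity,
  cancellation or totality.
\<close>

definition nsmul :: "nat \<Rightarrow> 'a::comm_monoid_add \<Rightarrow> 'a"  (infixr "\<cdot>" 75)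
  where "n \<cdot> x = (\<Sum>i<n. x)"

definition functional :: "('a::ordered_comm_monoid_add \<Rightarrow> real) \<Rightarrow> bool"
  where "functional f \<longleftrightarrow>
    (\<forall>x y. x \<ge> y \<longrightarrow> f x \<ge> f y) \<and> (\<forall>x y. f (x + y) = f x + f y) \<and> f 0 = 0"

definition numerical_via :: "('a::ordered_comm_monoid_add \<Rightarrow> real) \<Rightarrow> bool"
  where "numerical_via f \<longleftrightarrow> functional f \<and> (\<forall>x y. x \<ge> y \<longleftrightarrow> f x \<ge> f y)"

definition totally_ordered :: "'a::ordered_comm_monoid_add itself \<Rightarrow> bool"
  where "totally_ordered _ \<longleftrightarrow> (\<forall>x y :: 'a. x \<ge> y \<or> y \<ge> x)"

end

theory Submission
  imports Defs
begin

text \<open>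
  The theorem is a form of Hoelder's theorem on Archimedean ordered groups, carried out inside
  the monoid. Each of (b) and (c) says, in its own way, that a totally ordered \<open>A\<close> is
  cancellative and Archimedean: the multiples of a positive difference \<open>x - y\<close> eventually
  exceed any other difference \<open>b - a\<close>. Differences need not exist in \<open>A\<close>, so they are
  expressed by adding the subtracted term to the other side, \<open>n \<cdot> x + a \<ge> n \<cdot> y + b\<close>.
  The lemmas \<open>cancel_arch_if_mixing\<close> and \<open>cancel_arch_if_closed\<close> extract these two
  properties from (b) and from (c).

  Conversely, fix \<open>v < u\<close> and use the difference \<open>u - v\<close> as the unit of measurement. Every
  element \<open>x\<close> cuts the fractions \<open>(p - m) / q\<close> into those with \<open>(p - m)(u - v) \<le> q x\<close> and
  those with \<open>(p - m)(u - v) \<ge> q x\<close>. By totality each fraction lies on some side, by the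
  Archimedean property both sides are inhabited, and by cancellation they do not cross, so they
  determine a real number \<open>f x\<close>. Fractions below \<open>x\<close> and below \<open>y\<close> add up to fractions below
  \<open>x + y\<close>, and likewise above, so \<open>f\<close> is additive up to an error of at most \<open>4 / q\<close> for every
  \<open>q\<close>, hence additive. A strict inequality \<open>x > y\<close> is amplified by the Archimedean property
  until it is worth at least one unit, so \<open>f\<close> reflects the order (\<open>numerical_measure\<close>).

  A numerical functional translates (b) and (c) into elementary inequalities between reals. It
  is unique up to scaling because it recognises all the inequalities
  \<open>(p - m)(u - v) \<le> q x\<close>, which every other functional has to respect
  (\<open>functional_multiple_of_numerical\<close>).
\<close>

section \<open>Multiples and functionals\<close>

lemma nsmul_0 [simp]: "0 \<cdot> x = 0"
  by (simp add: nsmul_def)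

lemma nsmul_Suc: "Suc n \<cdot> x = x + n \<cdot> x"
  by (simp add: nsmul_def add.commute)

lemma nsmul_1 [simp]: "Suc 0 \<cdot> x = x"
  by (simp add: nsmul_Suc)

lemma nsmul_add_left: "(m + n) \<cdot> x = m \<cdot> x + n \<cdot> x"
  by (induction m) (simp_all add: nsmul_Suc add.assoc)

lemma nsmul_add: "n \<cdot> (x + y) = n \<cdot> x + n \<cdot> y"
  by (simp add: nsmul_def sum.distrib)

lemma nsmul_mult: "(m * n) \<cdot> x = m \<cdot> (n \<cdot> x)"
  by (induction m) (simp_all add: nsmul_Suc nsmul_add_left)

lemma nsmul_mono: "x \<le> y \<Longrightarrow> n \<cdot> x \<le> n \<cdot> (y :: 'a::ordered_comm_monoid_add)"
  by (induction n) (simp_all add: nsmul_Suc add_mono)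

lemma functional_add: "functional f \<Longrightarrow> f (x + y) = f x + f y"
  by (simp add: functional_def)

lemma functional_mono: "functional f \<Longrightarrow> x \<le> y \<Longrightarrow> f x \<le> f y"
  by (simp add: functional_def)

lemma functional_nsmul:
  assumes "functional f"
  shows "f (n \<cdot> x) = real n * f x"
  using assms by (induction n) (simp_all add: functional_def nsmul_Suc algebra_simps)

lemma numerical_via_le_iff: "numerical_via f \<Longrightarrow> x \<le> y \<longleftrightarrow> f x \<le> f y"
  by (auto simp: numerical_via_def)

lemma numerical_via_less_iff: "numerical_via f \<Longrightarrow> x < y \<longleftrightarrow> f x < f y"
  by (auto simp: less_le_not_le numerical_via_le_iff)

lemma eq_if_multiples_bounded:
  fixes a b C :: real
  assumes "\<And>q::nat. 0 < q \<Longrightarrow> \<bar>real q * a - real q * b\<bar> \<le> C"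
  shows "a = b"
proof (rule ccontr)
  assume "a \<noteq> b"
  then obtain q where q: "C < real q * \<bar>a - b\<bar>"
    using reals_Archimedean3[of "\<bar>a - b\<bar>"] by auto
  have "0 \<le> C" using assms[of 1] by linarith
  with q have "0 < q" by (cases "q = 0") auto
  from assms[OF this] have "real q * \<bar>a - b\<bar> \<le> C"
    by (simp add: abs_mult flip: right_diff_distrib)
  with q show False by simp
qed

section \<open>Cuts and the measuring functional\<close>

text \<open>
  \<open>cut_below u v q p m x\<close> encodes \<open>(p - m)(u - v) \<le> q x\<close> and \<open>cut_above\<close> the reverse
  inequality. Keeping \<open>p\<close> and \<open>m\<close> as separate natural numbers makes an arbitrary integer
  multiple of \<open>u - v\<close> available where there is no subtraction.
\<close>

definition cut_below :: "'a \<Rightarrow> 'a \<Rightarrow> nat \<Rightarrow> nat \<Rightarrow> nat \<Rightarrow> 'a::ordered_comm_monoid_add \<Rightarrow> bool"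
  where "cut_below u v q p m x \<longleftrightarrow> p \<cdot> u + m \<cdot> v \<le> q \<cdot> x + (p \<cdot> v + m \<cdot> u)"

definition cut_above :: "'a \<Rightarrow> 'a \<Rightarrow> nat \<Rightarrow> nat \<Rightarrow> nat \<Rightarrow> 'a::ordered_comm_monoid_add \<Rightarrow> bool"
  where "cut_above u v q p m x \<longleftrightarrow> q \<cdot> x + (p \<cdot> v + m \<cdot> u) \<le> p \<cdot> u + m \<cdot> v"

lemma functional_cut_below:
  assumes "functional f" "cut_below u v q p m x"
  shows "(real p - real m) * (f u - f v) \<le> real q * f x"
  using functional_mono[OF assms(1) assms(2)[unfolded cut_below_def]]
  by (simp add: functional_add[OF assms(1)] functional_nsmul[OF assms(1)] algebra_simps)

lemma functional_cut_above:
  assumes "functional f" "cut_above u v q p m x"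
  shows "real q * f x \<le> (real p - real m) * (f u - f v)"
  using functional_mono[OF assms(1) assms(2)[unfolded cut_above_def]]
  by (simp add: functional_add[OF assms(1)] functional_nsmul[OF assms(1)] algebra_simps)

lemma numerical_cut_below_iff:
  assumes "numerical_via f"
  shows "cut_below u v q p m x \<longleftrightarrow> (real p - real m) * (f u - f v) \<le> real q * f x"
proof -
  have "functional f" using assms by (simp add: numerical_via_def)
  then show ?thesis
    by (simp add: cut_below_def numerical_via_le_iff[OF assms] functional_add functional_nsmul
        algebra_simps)
qed

lemma numerical_cut_above_iff:
  assumes "numerical_via f"
  shows "cut_above u v q p m x \<longleftrightarrow> real q * f x \<le> (real p - real m) * (f u - f v)"
proof -
  have "functional f" using assms by (simp add: numerical_via_def)
  then show ?thesis
    by (simp add: cut_above_def numerical_via_le_iff[OF assms] functional_add functional_nsmul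
        algebra_simps)
qed

lemma cut_below_add:
  assumes "cut_below u v q p m x" "cut_below u v q p' m' y"
  shows "cut_below u v q (p + p') (m + m') (x + y)"
  using add_mono[OF assms[unfolded cut_below_def]]
  by (simp add: cut_below_def nsmul_add nsmul_add_left ac_simps)

lemma cut_above_add:
  assumes "cut_above u v q p m x" "cut_above u v q p' m' y"
  shows "cut_above u v q (p + p') (m + m') (x + y)"
  using add_mono[OF assms[unfolded cut_above_def]]
  by (simp add: cut_above_def nsmul_add nsmul_add_left ac_simps)

lemma cut_below_mono:
  assumes "cut_below u v q p m x" "x \<le> y"
  shows "cut_below u v q p m y"
  using assms unfolding cut_below_def by (meson add_right_mono nsmul_mono order_trans)

definition lower_fractions :: "'a \<Rightarrow> 'a \<Rightarrow> 'a::ordered_comm_monoid_add \<Rightarrow> real set"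
  where "lower_fractions u v x = {(real p - real m) / real q | q p m. 0 < q \<and> cut_below u v q p m x}"

definition unit_measure :: "'a \<Rightarrow> 'a \<Rightarrow> 'a::ordered_comm_monoid_add \<Rightarrow> real"
  where "unit_measure u v x = Sup (lower_fractions u v x)"

lemma floor_as_nat_difference:
  obtains p m :: nat where "real p - real m \<le> t" "t < real p - real m + 1"
proof
  show "real (nat \<lfloor>t\<rfloor>) - real (nat (- \<lfloor>t\<rfloor>)) \<le> t" by linarith
  show "t < real (nat \<lfloor>t\<rfloor>) - real (nat (- \<lfloor>t\<rfloor>)) + 1" by linarith
qed

locale archimedean_monoid_with_unit =
  fixes u v :: "'a::ordered_comm_monoid_add"
  assumes total: "x \<le> y \<or> y \<le> (x :: 'a)"
    and cancel: "x + z \<le> y + z \<Longrightarrow> x \<le> (y :: 'a)"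
    and arch: "y < (x :: 'a) \<Longrightarrow> \<exists>n. n \<cdot> y + b \<le> n \<cdot> x + a"
    and unit_pos: "v < u"
begin

lemma cut_below_or_above: "cut_below u v q p m x \<or> cut_above u v q p m x"
  using total unfolding cut_below_def cut_above_def by blast

lemma coefficient_le:
  assumes "P \<cdot> u + M \<cdot> v \<le> P \<cdot> v + M \<cdot> u"
  shows "P \<le> M"
proof (rule ccontr)
  assume "\<not> P \<le> M"
  then obtain d where P: "P = M + Suc d" using less_imp_Suc_add[of M P] by auto
  have "Suc d \<cdot> u + (M \<cdot> u + M \<cdot> v) \<le> Suc d \<cdot> v + (M \<cdot> u + M \<cdot> v)"
    using assms unfolding P nsmul_add_left by (simp add: ac_simps)
  then have "Suc d \<cdot> u \<le> Suc d \<cdot> v" by (rule cancel)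
  also have "Suc d \<cdot> v \<le> v + d \<cdot> u"
    using unit_pos by (simp add: nsmul_Suc add_left_mono nsmul_mono less_imp_le)
  finally have "u + d \<cdot> u \<le> v + d \<cdot> u" by (simp add: nsmul_Suc)
  then have "u \<le> v" by (rule cancel)
  with unit_pos show False by simp
qed

text \<open>
  The two sides of a cut do not cross: scaling both inequalities to the common multiple
  \<open>q q' x\<close> and cancelling it leaves a comparison between multiples of \<open>u - v\<close> alone.
\<close>

lemma cut_below_le_cut_above:
  assumes "0 < q" "0 < q'" and below: "cut_below u v q p m x" and above: "cut_above u v q' p' m' x"
  shows "(real p - real m) / real q \<le> (real p' - real m') / real q'"
proof -
  let ?P = "q' * p + q * m'" and ?M = "q' * m + q * p'" and ?X = "(q * q') \<cdot> x"
  have "q' \<cdot> (p \<cdot> u + m \<cdot> v) \<le> q' \<cdot> (q \<cdot> x + (p \<cdot> v + m \<cdot> u))"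
    and "q \<cdot> (q' \<cdot> x + (p' \<cdot> v + m' \<cdot> u)) \<le> q \<cdot> (p' \<cdot> u + m' \<cdot> v)"
    using below above by (auto simp: cut_below_def cut_above_def intro: nsmul_mono)
  then have lower: "(q' * p) \<cdot> u + (q' * m) \<cdot> v \<le> ?X + ((q' * p) \<cdot> v + (q' * m) \<cdot> u)"
    and upper: "?X + ((q * p') \<cdot> v + (q * m') \<cdot> u) \<le> (q * p') \<cdot> u + (q * m') \<cdot> v"
    by (simp_all only: nsmul_add nsmul_mult[symmetric] mult.commute[of q' q])
  have "(?P \<cdot> u + ?M \<cdot> v) + ?X \<le> (?P \<cdot> v + ?M \<cdot> u) + ?X"
    using add_mono[OF lower upper] by (simp add: nsmul_add_left ac_simps)
  then have "?P \<le> ?M" by (rule coefficient_le[OF cancel])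
  then have "real ?P \<le> real ?M" by (rule of_nat_mono)
  then show ?thesis using assms(1,2) by (simp add: field_simps)
qed

lemma cut_below_exists: "\<exists>m. cut_below u v 1 0 m x"
  using arch[OF unit_pos, of 0 x] by (auto simp: cut_below_def ac_simps)

lemma cut_above_exists: "\<exists>p. cut_above u v 1 p 0 x"
  using arch[OF unit_pos, of x 0] by (auto simp: cut_above_def ac_simps)

lemma lower_fractions_nonempty: "lower_fractions u v x \<noteq> {}"
  using cut_below_exists[of x] zero_less_one unfolding lower_fractions_def by blast

lemma bdd_above_lower_fractions: "bdd_above (lower_fractions u v x)"
proof -
  obtain p where p: "cut_above u v 1 p 0 x" using cut_above_exists by blast
  show ?thesis
    using cut_below_le_cut_above[OF _ zero_less_one _ p]
    by (intro bdd_aboveI[of _ "(real p - real 0) / real 1"]) (auto simp: lower_fractions_def)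
qed

lemma cut_below_imp_le_measure:
  assumes "0 < q" "cut_below u v q p m x"
  shows "(real p - real m) \<le> real q * unit_measure u v x"
proof -
  have "(real p - real m) / real q \<le> unit_measure u v x"
    unfolding unit_measure_def using assms
    by (intro cSup_upper bdd_above_lower_fractions) (auto simp: lower_fractions_def)
  then show ?thesis using assms(1) by (simp add: field_simps)
qed

lemma cut_above_imp_measure_le:
  assumes "0 < q" "cut_above u v q p m x"
  shows "real q * unit_measure u v x \<le> (real p - real m)"
proof -
  have "unit_measure u v x \<le> (real p - real m) / real q"
    unfolding unit_measure_def using cut_below_le_cut_above[OF _ assms(1) _ assms(2)]
    by (intro cSup_least lower_fractions_nonempty) (auto simp: lower_fractions_def)
  then show ?thesis using assms(1) by (simp add: field_simps)
qed

text \<open>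
  A fraction strictly below the measure of \<open>x\<close> lies below \<open>x\<close>, but for one equal to the
  measure totality alone does not tell the side; hence the unit of slack below the floor.
\<close>

lemma cut_approximation:
  assumes "0 < q"
  obtains p m where "cut_below u v q p (m + 1) x" "cut_above u v q (p + 1) m x"
    "\<bar>real q * unit_measure u v x - (real p - real m)\<bar> \<le> 1"
proof -
  obtain p m where pm: "real p - real m \<le> real q * unit_measure u v x"
    "real q * unit_measure u v x < real p - real m + 1"
    by (rule floor_as_nat_difference)
  show thesis
  proof (rule that)
    have "\<not> cut_above u v q p (m + 1) x"
      using cut_above_imp_measure_le[OF assms, of p "m + 1" x] pm by auto
    then show "cut_below u v q p (m + 1) x" using cut_below_or_above by blast
    have "\<not> cut_below u v q (p + 1) m x"
      using cut_below_imp_le_measure[OF assms, of "p + 1" m x] pm by auto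
    then show "cut_above u v q (p + 1) m x" using cut_below_or_above by blast
    show "\<bar>real q * unit_measure u v x - (real p - real m)\<bar> \<le> 1" using pm by linarith
  qed
qed

lemma measure_add: "unit_measure u v (x + y) = unit_measure u v x + unit_measure u v y"
proof (rule eq_if_multiples_bounded[where C = 4])
  fix q :: nat assume q: "0 < q"
  obtain p m where x: "cut_below u v q p (m + 1) x" "cut_above u v q (p + 1) m x"
    "\<bar>real q * unit_measure u v x - (real p - real m)\<bar> \<le> 1"
    using cut_approximation[OF q] .
  obtain p' m' where y: "cut_below u v q p' (m' + 1) y" "cut_above u v q (p' + 1) m' y"
    "\<bar>real q * unit_measure u v y - (real p' - real m')\<bar> \<le> 1"
    using cut_approximation[OF q] .
  have "real (p + p') - real (m + 1 + (m' + 1)) \<le> real q * unit_measure u v (x + y)"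
    using cut_below_add[OF x(1) y(1)] by (rule cut_below_imp_le_measure[OF q])
  moreover have "real q * unit_measure u v (x + y) \<le> real (p + 1 + (p' + 1)) - real (m + m')"
    using cut_above_add[OF x(2) y(2)] by (rule cut_above_imp_measure_le[OF q])
  ultimately show
    "\<bar>real q * unit_measure u v (x + y) - real q * (unit_measure u v x + unit_measure u v y)\<bar> \<le> 4"
    using x(3) y(3) by (simp add: distrib_left)
qed

lemma measure_mono: "x \<le> y \<Longrightarrow> unit_measure u v x \<le> unit_measure u v y"
  unfolding unit_measure_def
  by (intro cSup_subset_mono lower_fractions_nonempty bdd_above_lower_fractions)
    (auto simp: lower_fractions_def intro: cut_below_mono)

lemma functional_measure: "functional (unit_measure u v)"
  using measure_add[of 0 0] by (simp add: functional_def measure_add measure_mono)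

lemma measure_unit_pos: "unit_measure u v v < unit_measure u v u"
proof -
  \<comment> \<open>The denominator 3 beats the total slack 2 in the estimate for \<open>v\<close>.\<close>
  obtain p m where below: "cut_below u v 3 p (m + 1) v"
    and approx: "\<bar>real 3 * unit_measure u v v - (real p - real m)\<bar> \<le> 1"
    using cut_approximation[OF zero_less_numeral] by blast
  have "cut_below u v 3 (p + 3) (m + 1) u"
    using add_left_mono[OF below[unfolded cut_below_def], of "3 \<cdot> u"]
    unfolding cut_below_def nsmul_add_left by (simp add: ac_simps)
  then have "real (p + 3) - real (m + 1) \<le> real 3 * unit_measure u v u"
    by (intro cut_below_imp_le_measure) auto
  with approx show ?thesis by simp
qed

text \<open>
  If \<open>x > y\<close>, then by the Archimedean property some multiple of \<open>x\<close> exceeds the same multiple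
  of \<open>y\<close> by at least one unit, and the measure sees a unit.
\<close>

lemma numerical_measure: "numerical_via (unit_measure u v)"
proof -
  have "y \<le> x" if "unit_measure u v y \<le> unit_measure u v x" for x y
  proof (rule ccontr)
    assume "\<not> y \<le> x"
    with total[of x y] have "x < y" by (simp add: less_le_not_le)
    then obtain n where "n \<cdot> x + u \<le> n \<cdot> y + v" using arch by blast
    from functional_mono[OF functional_measure this]
    have "real n * unit_measure u v x + unit_measure u v u
        \<le> real n * unit_measure u v y + unit_measure u v v"
      by (simp add: functional_add[OF functional_measure] functional_nsmul[OF functional_measure])
    moreover have "real n * unit_measure u v y \<le> real n * unit_measure u v x"
      using that by (simp add: mult_left_mono)
    ultimately show False using measure_unit_pos by linarith
  qed
  then show ?thesis
    using functional_measure measure_mono by (auto simp: numerical_via_def)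
qed

end

lemma numerical_if_cancel_arch:
  assumes total: "\<And>x y :: 'a::ordered_comm_monoid_add. x \<le> y \<or> y \<le> x"
    and cancel: "\<And>x y z :: 'a. x + z \<le> y + z \<Longrightarrow> x \<le> y"
    and arch: "\<And>x y a b :: 'a. y < x \<Longrightarrow> \<exists>n. n \<cdot> y + b \<le> n \<cdot> x + a"
  shows "\<exists>f :: 'a \<Rightarrow> real. numerical_via f"
proof (cases "\<exists>u v :: 'a. v < u")
  case True
  then obtain u v :: 'a where "v < u" by blast
  with assms interpret archimedean_monoid_with_unit u v by unfold_locales blast+
  show ?thesis using numerical_measure by blast
next
  case False
  with total have "x \<le> y" for x y :: 'a by (metis order_le_less)
  then have "numerical_via (\<lambda>_ :: 'a. 0)" by (auto simp: numerical_via_def functional_def)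
  then show ?thesis by blast
qed

section \<open>Uniqueness up to scaling\<close>

text \<open>
  With \<open>d = f u - f v\<close>, the integers \<open>p - m\<close> and \<open>p - m + 1\<close> around \<open>q f x / d\<close> give a cut
  below and a cut above \<open>x\<close>, because \<open>f\<close> is numerical; the functional \<open>f'\<close> must respect both.
  So \<open>q f' x\<close> and \<open>q f x d' / d\<close> lie in the same interval of length \<open>d' = f' u - f' v\<close>,
  whatever the value of \<open>q\<close>.
\<close>

lemma functional_multiple_of_numerical:
  fixes f f' :: "'a::ordered_comm_monoid_add \<Rightarrow> real"
  assumes f: "numerical_via f" and f': "functional f'"
  shows "\<exists>c. \<forall>x. f' x = c * f x"
proof (cases "\<exists>u v :: 'a. v < u")
  case True
  then obtain u v :: 'a where uv: "v < u" by blast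
  define d d' where "d = f u - f v" and "d' = f' u - f' v"
  have d: "0 < d" using uv numerical_via_less_iff[OF f] by (simp add: d_def)
  have d': "0 \<le> d'" using uv functional_mono[OF f', of v u] by (simp add: d'_def)
  have "f' x = d' / d * f x" for x
  proof (rule eq_if_multiples_bounded[where C = d'])
    fix q :: nat
    obtain p m where pm: "real p - real m \<le> real q * f x / d"
      "real q * f x / d < real p - real m + 1"
      by (rule floor_as_nat_difference)
    have "cut_below u v q p m x"
      using pm(1) d by (simp add: numerical_cut_below_iff[OF f] field_simps flip: d_def)
    from functional_cut_below[OF f' this]
    have lower: "(real p - real m) * d' \<le> real q * f' x" by (simp add: d'_def)
    have "cut_above u v q (p + 1) m x"
      using pm(2) d by (simp add: numerical_cut_above_iff[OF f] field_simps flip: d_def)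
    from functional_cut_above[OF f' this]
    have upper: "real q * f' x \<le> (real p - real m) * d' + d'"
      by (simp add: d'_def algebra_simps)
    have "(real p - real m) * d' \<le> real q * (d' / d * f x)"
      using mult_right_mono[OF pm(1) d'] by (simp add: ac_simps)
    moreover have "real q * (d' / d * f x) \<le> (real p - real m) * d' + d'"
      using mult_right_mono[OF less_imp_le[OF pm(2)] d'] by (simp add: algebra_simps)
    ultimately show "\<bar>real q * f' x - real q * (d' / d * f x)\<bar> \<le> d'"
      using lower upper by linarith
  qed
  then show ?thesis by blast
next
  case False
  \<comment> \<open>The monoid is a single point, on which every functional vanishes.\<close>
  have "x = 0" for x :: 'a
    using False numerical_via_le_iff[OF f] by (metis linear order_le_less)
  then show ?thesis using f' by (metis functional_def mult_zero_left)
qed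

section \<open>Axioms implying cancellation and the Archimedean property\<close>

text \<open>
  Given \<open>x > y\<close> and \<open>a < b\<close>, apply the mixing condition to the chain
  \<open>x + b > y + b > y + a\<close> with \<open>k = 1\<close> and \<open>n\<close> large. Cancelling what both sides have in common
  leaves \<open>(n - 1) y + b < (n - 1) x + a\<close>.
\<close>

lemma cancel_arch_if_mixing:
  fixes x y a b z :: "'a::ordered_comm_monoid_add"
  assumes total: "\<And>x y :: 'a. x \<le> y \<or> y \<le> x"
    and strict: "\<And>x y z :: 'a. y < x \<Longrightarrow> y + z < x + z"
    and mixing: "\<And>x y z :: 'a. y < x \<Longrightarrow> z < y \<Longrightarrow> \<exists>\<epsilon> :: rat. 0 < \<epsilon> \<and>
      (\<forall>n k :: nat. n \<ge> 1 \<and> of_nat k \<le> \<epsilon> * of_nat n \<longrightarrow> n \<cdot> y < (n - k) \<cdot> x + k \<cdot> z)"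
  shows "x + z \<le> y + z \<Longrightarrow> x \<le> y"
    and "y < x \<Longrightarrow> \<exists>n. n \<cdot> y + b \<le> n \<cdot> x + a"
proof -
  show cancel: "x \<le> y" if "x + z \<le> y + z" for x y z :: 'a
    using that total[of x y] strict[of y x z] by (auto simp: less_le_not_le)
  show "\<exists>n. n \<cdot> y + b \<le> n \<cdot> x + a" if "y < x"
  proof (cases "b \<le> a")
    case True
    then have "0 \<cdot> y + b \<le> 0 \<cdot> x + a" by simp
    then show ?thesis by blast
  next
    case False
    with total[of a b] have "a < b" by (simp add: less_le_not_le)
    then have "y + a < y + b" using strict[of a b y] by (simp add: add.commute)
    moreover have "y + b < x + b" using strict[OF that] .
    ultimately obtain \<epsilon> :: rat where "0 < \<epsilon>" and \<epsilon>: "\<And>n k :: nat.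
        n \<ge> 1 \<Longrightarrow> of_nat k \<le> \<epsilon> * of_nat n \<Longrightarrow> n \<cdot> (y + b) < (n - k) \<cdot> (x + b) + k \<cdot> (y + a)"
      using mixing by metis
    then obtain N :: nat where "1 < of_nat N * \<epsilon>"
      using ex_less_of_nat_mult by blast
    moreover from this obtain n where "N = Suc n" by (cases N) auto
    ultimately have "Suc n \<cdot> (y + b) < (Suc n - 1) \<cdot> (x + b) + 1 \<cdot> (y + a)"
      by (intro \<epsilon>) (auto simp: mult.commute)
    then have "(n \<cdot> y + b) + (y + n \<cdot> b) \<le> (n \<cdot> x + a) + (y + n \<cdot> b)"
      by (simp add: nsmul_Suc nsmul_add ac_simps less_imp_le)
    then show ?thesis using cancel by blast
  qed
qed

text \<open>
  For \<open>k = 1\<close> the closedness condition says that \<open>y \<le> x\<close> as soon as \<open>n (y - x)\<close> is bounded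
  by \<open>a - b\<close> for all \<open>n\<close>. Iterating \<open>x + z \<le> y + z\<close> gives \<open>n x + z \<le> n y + z\<close>, such a bound
  with \<open>a = b = z\<close>, whence cancellation; a failure of the Archimedean property for \<open>y < x\<close>
  gives such a bound for the opposite inequality \<open>x \<le> y\<close>.
\<close>

lemma cancel_arch_if_closed:
  fixes x y a b z :: "'a::ordered_comm_monoid_add"
  assumes total: "\<And>x y :: 'a. x \<le> y \<or> y \<le> x"
    and closed: "\<And>x y zp zm :: 'a. (\<And>\<epsilon> :: rat. \<epsilon> > 0 \<Longrightarrow> \<exists>n k :: nat. n \<ge> 1 \<and>
      of_nat k \<le> \<epsilon> * of_nat n \<and> n \<cdot> y + k \<cdot> zm \<le> n \<cdot> x + k \<cdot> zp) \<Longrightarrow> y \<le> x"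
  shows "x + z \<le> y + z \<Longrightarrow> x \<le> y"
    and "y < x \<Longrightarrow> \<exists>n. n \<cdot> y + b \<le> n \<cdot> x + a"
proof -
  have bounded_error: "y \<le> x" if "\<And>n. n \<cdot> y + b \<le> n \<cdot> x + a" for x y a b :: 'a
  proof (rule closed)
    fix \<epsilon> :: rat assume "0 < \<epsilon>"
    then obtain n :: nat where n: "1 < of_nat n * \<epsilon>" using ex_less_of_nat_mult by blast
    then have "n \<ge> 1" by (cases n) auto
    with n that[of n]
    show "\<exists>n k :: nat. n \<ge> 1 \<and> of_nat k \<le> \<epsilon> * of_nat n \<and> n \<cdot> y + k \<cdot> b \<le> n \<cdot> x + k \<cdot> a"
      by (intro exI[of _ n] exI[of _ 1]) (simp add: mult.commute)
  qed
  show "x \<le> y" if le: "x + z \<le> y + z"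
  proof (rule bounded_error)
    fix n show "n \<cdot> x + z \<le> n \<cdot> y + z"
    proof (induction n)
      case (Suc n)
      have "Suc n \<cdot> x + z = x + (n \<cdot> x + z)" by (simp add: nsmul_Suc ac_simps)
      also have "\<dots> \<le> x + (n \<cdot> y + z)" using Suc by (rule add_left_mono)
      also have "\<dots> = n \<cdot> y + (x + z)" by (simp add: ac_simps)
      also have "\<dots> \<le> n \<cdot> y + (y + z)" using le by (rule add_left_mono)
      also have "\<dots> = Suc n \<cdot> y + z" by (simp add: nsmul_Suc ac_simps)
      finally show ?case .
    qed simp
  qed
  show "\<exists>n. n \<cdot> y + b \<le> n \<cdot> x + a" if "y < x"
  proof (rule ccontr)
    assume "\<not> ?thesis"
    then have "x \<le> y" using total by (intro bounded_error[of x a y b]) blast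
    with that show False by simp
  qed
qed

section \<open>Consequences of a numerical functional\<close>

lemma totally_ordered_if_numerical:
  fixes f :: "'a::ordered_comm_monoid_add \<Rightarrow> real"
  shows "numerical_via f \<Longrightarrow> totally_ordered TYPE('a)"
  by (simp add: totally_ordered_def numerical_via_le_iff linear)

text \<open>
  Writing \<open>s = f x - f y\<close> and \<open>t = f y - f z\<close>, the two inequalities say
  \<open>k (s + t) < n s\<close> and \<open>k (s + t) < n t\<close>, so any positive rational \<open>\<epsilon>\<close> below
  \<open>s / (s + t)\<close> and \<open>t / (s + t)\<close> will do.
\<close>

lemma mixing_if_numerical:
  fixes f :: "'a::ordered_comm_monoid_add \<Rightarrow> real" and x y z :: 'a
  assumes f: "numerical_via f" and "y < x" "z < y"
  shows "\<exists>\<epsilon> :: rat. 0 < \<epsilon> \<and> \<epsilon> < 1 \<and>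
    (\<forall>n k :: nat. n \<ge> 1 \<and> of_nat k \<le> \<epsilon> * of_nat n \<longrightarrow>
      (n - k) \<cdot> x + k \<cdot> z > n \<cdot> y \<and> n \<cdot> y > k \<cdot> x + (n - k) \<cdot> z)"
proof -
  have fun_f: "functional f" using f by (simp add: numerical_via_def)
  define s t where "s = f x - f y" and "t = f y - f z"
  have st: "0 < s" "0 < t"
    using assms(2,3) by (simp_all add: s_def t_def numerical_via_less_iff[OF f])
  then have "0 < min s t / (s + t)" by simp
  then obtain \<epsilon> :: rat where \<epsilon>: "0 < real_of_rat \<epsilon>" "real_of_rat \<epsilon> < min s t / (s + t)"
    using of_rat_dense by blast
  have "min s t / (s + t) < 1" using st by simp
  with \<epsilon> have "real_of_rat \<epsilon> < 1" by linarith
  with \<epsilon>(1) have \<epsilon>01: "0 < \<epsilon>" "\<epsilon> < 1" by simp_all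
  have "(n - k) \<cdot> x + k \<cdot> z > n \<cdot> y \<and> n \<cdot> y > k \<cdot> x + (n - k) \<cdot> z"
    if n: "n \<ge> 1" and k: "of_nat k \<le> \<epsilon> * of_nat n" for n k :: nat
  proof -
    have k_real: "real k \<le> real_of_rat \<epsilon> * real n"
      using k by (metis of_rat_less_eq of_rat_mult of_rat_of_nat_eq)
    also have "\<dots> \<le> 1 * real n" using \<epsilon>01 by (intro mult_right_mono) auto
    finally have "k \<le> n" by simp
    have "real k * (s + t) \<le> (real_of_rat \<epsilon> * (s + t)) * real n"
      using k_real st mult_right_mono[OF k_real, of "s + t"] by (simp add: ac_simps)
    also have "\<dots> < min s t * real n"
      using \<epsilon>(2) st n by (intro mult_strict_right_mono) (simp_all add: pos_less_divide_eq)
    finally have "real k * (s + t) < min s t * real n" .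
    moreover have "min s t * real n \<le> s * real n" "min s t * real n \<le> t * real n"
      by (simp_all add: mult_right_mono)
    ultimately have "real k * (s + t) < s * real n" "real k * (s + t) < t * real n"
      by linarith+
    then show ?thesis
      using \<open>k \<le> n\<close>
      by (simp add: numerical_via_less_iff[OF f] functional_add[OF fun_f]
          functional_nsmul[OF fun_f] of_nat_diff s_def t_def algebra_simps)
  qed
  with \<epsilon>01 show ?thesis by blast
qed

text \<open>
  Dividing the hypothesis by \<open>n\<close> bounds \<open>f y - f x\<close> by \<open>\<epsilon> \<bar>f zp - f zm\<bar>\<close>, which is arbitrarily
  small. The constant \<open>C\<close> is made positive so that one can divide by it.
\<close>

lemma closed_if_numerical:
  fixes f :: "'a::ordered_comm_monoid_add \<Rightarrow> real" and x y zp zm :: 'a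
  assumes f: "numerical_via f"
    and approx: "\<And>\<epsilon> :: rat. \<epsilon> > 0 \<Longrightarrow> \<exists>n k :: nat. n \<ge> 1 \<and> of_nat k \<le> \<epsilon> * of_nat n \<and>
      n \<cdot> x + k \<cdot> zp \<ge> n \<cdot> y + k \<cdot> zm"
  shows "x \<ge> y"
proof (rule ccontr)
  assume "\<not> x \<ge> y"
  then have less: "0 < f y - f x" by (simp add: numerical_via_le_iff[OF f])
  have fun_f: "functional f" using f by (simp add: numerical_via_def)
  define C where "C = \<bar>f zp - f zm\<bar> + 1"
  have C: "0 < C" by (simp add: C_def add_nonneg_pos)
  then obtain \<epsilon> :: rat where \<epsilon>: "0 < real_of_rat \<epsilon>" "real_of_rat \<epsilon> < (f y - f x) / C"
    using of_rat_dense less divide_pos_pos by metis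
  then obtain n k :: nat where n: "n \<ge> 1" and k: "of_nat k \<le> \<epsilon> * of_nat n"
    and le: "n \<cdot> y + k \<cdot> zm \<le> n \<cdot> x + k \<cdot> zp"
    using approx[of \<epsilon>] by auto
  have k_real: "real k \<le> real_of_rat \<epsilon> * real n"
    using k by (metis of_rat_less_eq of_rat_mult of_rat_of_nat_eq)
  have "real n * (f y - f x) \<le> real k * (f zp - f zm)"
    using functional_mono[OF fun_f le]
    by (simp add: functional_add[OF fun_f] functional_nsmul[OF fun_f] algebra_simps)
  also have "\<dots> \<le> real k * C" by (intro mult_left_mono) (auto simp: C_def)
  also have "\<dots> \<le> (real_of_rat \<epsilon> * real n) * C"
    using C by (intro mult_right_mono k_real) simp
  also have "\<dots> = real n * (real_of_rat \<epsilon> * C)" by simp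
  also have "\<dots> < real n * (f y - f x)"
    using \<epsilon>(2) C n by (intro mult_strict_left_mono) (simp_all add: pos_less_divide_eq)
  finally show False by simp
qed

section \<open>The characterization\<close>

theorem theorem9p4:
  shows "((\<exists>f :: 'a::ordered_comm_monoid_add \<Rightarrow> real. numerical_via f) \<longleftrightarrow>
      totally_ordered TYPE('a) \<and>
      (\<forall>x y :: 'a. x > y \<longrightarrow> (\<forall>z. x + z > y + z)) \<and>
      (\<forall>x y z :: 'a. x > y \<and> y > z \<longrightarrow>
        (\<exists>\<epsilon> :: rat. 0 < \<epsilon> \<and> \<epsilon> < 1 \<and>
          (\<forall>n k :: nat. n \<ge> 1 \<and> of_nat k \<le> \<epsilon> * of_nat n \<longrightarrow>
            (n - k) \<cdot> x + k \<cdot> z > n \<cdot> y \<and> n \<cdot> y > k \<cdot> x + (n - k) \<cdot> z))))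
    \<and>
    ((\<exists>f :: 'a \<Rightarrow> real. numerical_via f) \<longleftrightarrow>
      totally_ordered TYPE('a) \<and>
      (\<forall>x y z\<^sub>p z\<^sub>m :: 'a.
        (\<forall>\<epsilon> :: rat. \<epsilon> > 0 \<longrightarrow>
          (\<exists>n k :: nat. n \<ge> 1 \<and> of_nat k \<le> \<epsilon> * of_nat n \<and>
            n \<cdot> x + k \<cdot> z\<^sub>p \<ge> n \<cdot> y + k \<cdot> z\<^sub>m)) \<longrightarrow>
        x \<ge> y))
    \<and>
    (\<forall>f :: 'a \<Rightarrow> real. numerical_via f \<longrightarrow>
      (\<forall>f' :: 'a \<Rightarrow> real. functional f' \<longrightarrow> (\<exists>c :: real. \<forall>x. f' x = c * f x)))"
proof (intro conjI)
  let ?N = "\<exists>f :: 'a \<Rightarrow> real. numerical_via f"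
  let ?strict = "\<forall>x y :: 'a. x > y \<longrightarrow> (\<forall>z. x + z > y + z)"
  let ?mixing = "\<forall>x y z :: 'a. x > y \<and> y > z \<longrightarrow>
    (\<exists>\<epsilon> :: rat. 0 < \<epsilon> \<and> \<epsilon> < 1 \<and>
      (\<forall>n k :: nat. n \<ge> 1 \<and> of_nat k \<le> \<epsilon> * of_nat n \<longrightarrow>
        (n - k) \<cdot> x + k \<cdot> z > n \<cdot> y \<and> n \<cdot> y > k \<cdot> x + (n - k) \<cdot> z))"
  let ?closed = "\<forall>x y zp zm :: 'a.
    (\<forall>\<epsilon> :: rat. \<epsilon> > 0 \<longrightarrow>
      (\<exists>n k :: nat. n \<ge> 1 \<and> of_nat k \<le> \<epsilon> * of_nat n \<and>
        n \<cdot> x + k \<cdot> zp \<ge> n \<cdot> y + k \<cdot> zm)) \<longrightarrow>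
    x \<ge> y"
  show "?N \<longleftrightarrow> totally_ordered TYPE('a) \<and> ?strict \<and> ?mixing"
  proof
    assume ?N
    then obtain f :: "'a \<Rightarrow> real" where f: "numerical_via f" by blast
    have ?strict
      using f by (simp add: numerical_via_less_iff[OF f] numerical_via_def functional_add)
    moreover have ?mixing using mixing_if_numerical[OF f] by blast
    ultimately show "totally_ordered TYPE('a) \<and> ?strict \<and> ?mixing"
      using totally_ordered_if_numerical[OF f] by blast
  next
    assume b: "totally_ordered TYPE('a) \<and> ?strict \<and> ?mixing"
    have total: "x \<le> y \<or> y \<le> x" for x y :: 'a using b by (auto simp: totally_ordered_def)
    have strict: "y + z < x + z" if "y < x" for x y z :: 'a using b that by blast
    have mixing: "\<exists>\<epsilon> :: rat. 0 < \<epsilon> \<and>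
        (\<forall>n k :: nat. n \<ge> 1 \<and> of_nat k \<le> \<epsilon> * of_nat n \<longrightarrow> n \<cdot> y < (n - k) \<cdot> x + k \<cdot> z)"
      if "y < x" "z < y" for x y z :: 'a
      using b that by meson
    show ?N
      using total cancel_arch_if_mixing[OF total strict mixing] by (rule numerical_if_cancel_arch)
  qed
  show "?N \<longleftrightarrow> totally_ordered TYPE('a) \<and> ?closed"
  proof
    assume ?N
    then obtain f :: "'a \<Rightarrow> real" where f: "numerical_via f" by blast
    have ?closed using closed_if_numerical[OF f] by blast
    with totally_ordered_if_numerical[OF f] show "totally_ordered TYPE('a) \<and> ?closed" by blast
  next
    assume c: "totally_ordered TYPE('a) \<and> ?closed"
    have total: "x \<le> y \<or> y \<le> x" for x y :: 'a using c by (auto simp: totally_ordered_def)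
    have closed: "y \<le> x" if "\<And>\<epsilon> :: rat. \<epsilon> > 0 \<Longrightarrow> \<exists>n k :: nat. n \<ge> 1 \<and>
        of_nat k \<le> \<epsilon> * of_nat n \<and> n \<cdot> y + k \<cdot> zm \<le> n \<cdot> x + k \<cdot> zp" for x y zp zm :: 'a
      using c that by blast
    show ?N
      using total cancel_arch_if_closed[OF total closed] by (rule numerical_if_cancel_arch)
  qed
  show "\<forall>f :: 'a \<Rightarrow> real. numerical_via f \<longrightarrow>
      (\<forall>f' :: 'a \<Rightarrow> real. functional f' \<longrightarrow> (\<exists>c :: real. \<forall>x. f' x = c * f x))"
    using functional_multiple_of_numerical by blast
qed

end
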